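(* Let $1\le p<\infty$ and let $X$ be a Banach space. In each of the following three versions (a), (b), (c) separately, the statements (i), (ii), (iii) are equivalent. (a) Weakly precompact version: (i) For every Banach space $Y$, if $T:X\to Y$ is a $p$-convergent operator, then $T^*:Y^*\to X^*$ is weakly precompact. (ii) The same as (i) with $Y=\ell_\infty$. (iii) Every weakly-$p$-$L$-subset of $X^*$ is weakly precompact. (b) Weakly compact version: (i) For every Banach space $Y$, if $T:X\to Y$ is a $p$-convergent operator, then $T^*:Y^*\to X^*$ is weakly compact. (ii) The same as (i) with $Y=\ell_\infty$. (iii) Every weakly-$p$-$L$-subset of $X^*$ is relatively weakly compact. (c) Compact version: (i) For every Banach space $Y$, if $T:X\to Y$ is a $p$-convergent operator, then $T^*:Y^*\to X^*$ is compact. (ii) The same as (i) with $Y=\ell_\infty$. (iii) Every weakly-$p$-$L$-subset of $X^*$ is relatively compact.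
   Context: Operators are continuous linear maps between Banach spaces. A sequence $(x_n)$ in a Banach space $E$ is weakly $p$-summable if $(x^*(x_n))_n\in\ell_p$ for every $x^*\in E^*$. An operator is $p$-convergent if it maps weakly $p$-summable sequences to norm null sequences. A bounded subset $A$ of $X^*$ is a weakly-$p$-$L$-set (weakly-$p$-$L$-subset of $X^*$) if $\sup_{x^*\in A}|x^*(x_n)|\to 0$ for every weakly $p$-summable sequence $(x_n)$ in $X$. A subset $S$ of a Banach space is weakly precompact if every sequence from $S$ has a weakly Cauchy subsequence; an operator is weakly precompact if the image of the unit ball is weakly precompact. (Version (b)(iii) is what the paper calls property $RDP_p$ of $X$, and version (a)(iii) property $wRDP_p$.) *)

theory Defs
  imports "HOL-Analysis.Analysis"
begin

section \<open>Banach spaces with explicit carrier\<close>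

text \<open>
  A statement of the form ``for every Banach space \<open>Y\<close>'' cannot quantify over types inside a formula.
  Real Banach spaces that have to be quantified over are therefore given by a carrier set and
  operations; spaces that are fixed throughout a statement are types of class \<^class>\<open>banach\<close>.
\<close>

record 'u nspace =
  carrier :: "'u set"
  vzero :: "'u"
  vadd :: "'u \<Rightarrow> 'u \<Rightarrow> 'u"
  vscale :: "real \<Rightarrow> 'u \<Rightarrow> 'u"
  vnorm :: "'u \<Rightarrow> real"

locale normed_space_on =
  fixes Y :: "'u nspace"
  assumes zero_closed: "vzero Y \<in> carrier Y"
    and add_closed: "\<lbrakk>x \<in> carrier Y; y \<in> carrier Y\<rbrakk> \<Longrightarrow> vadd Y x y \<in> carrier Y"
    and scale_closed: "x \<in> carrier Y \<Longrightarrow> vscale Y a x \<in> carrier Y"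
    and add_assoc: "\<lbrakk>x \<in> carrier Y; y \<in> carrier Y; z \<in> carrier Y\<rbrakk>
      \<Longrightarrow> vadd Y (vadd Y x y) z = vadd Y x (vadd Y y z)"
    and add_commute: "\<lbrakk>x \<in> carrier Y; y \<in> carrier Y\<rbrakk> \<Longrightarrow> vadd Y x y = vadd Y y x"
    and add_zero: "x \<in> carrier Y \<Longrightarrow> vadd Y (vzero Y) x = x"
    and add_inverse: "x \<in> carrier Y \<Longrightarrow> vadd Y x (vscale Y (- 1) x) = vzero Y"
    and scale_add_right: "\<lbrakk>x \<in> carrier Y; y \<in> carrier Y\<rbrakk>
      \<Longrightarrow> vscale Y a (vadd Y x y) = vadd Y (vscale Y a x) (vscale Y a y)"
    and scale_add_left: "x \<in> carrier Y
      \<Longrightarrow> vscale Y (a + b) x = vadd Y (vscale Y a x) (vscale Y b x)"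
    and scale_scale: "x \<in> carrier Y \<Longrightarrow> vscale Y a (vscale Y b x) = vscale Y (a * b) x"
    and scale_one: "x \<in> carrier Y \<Longrightarrow> vscale Y 1 x = x"
    and norm_nonneg: "x \<in> carrier Y \<Longrightarrow> 0 \<le> vnorm Y x"
    and norm_eq_zero: "x \<in> carrier Y \<Longrightarrow> vnorm Y x = 0 \<longleftrightarrow> x = vzero Y"
    and norm_triangle: "\<lbrakk>x \<in> carrier Y; y \<in> carrier Y\<rbrakk>
      \<Longrightarrow> vnorm Y (vadd Y x y) \<le> vnorm Y x + vnorm Y y"
    and norm_scale: "x \<in> carrier Y \<Longrightarrow> vnorm Y (vscale Y a x) = \<bar>a\<bar> * vnorm Y x"

definition vdist :: "'u nspace \<Rightarrow> 'u \<Rightarrow> 'u \<Rightarrow> real" where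
  "vdist Y x y = vnorm Y (vadd Y x (vscale Y (- 1) y))"

locale banach_space_on = normed_space_on +
  assumes complete: "\<lbrakk>\<And>n. s n \<in> carrier Y;
      \<And>e. e > 0 \<Longrightarrow> \<exists>N. \<forall>m\<ge>N. \<forall>n\<ge>N. vdist Y (s m) (s n) < e\<rbrakk>
    \<Longrightarrow> \<exists>l\<in>carrier Y. (\<lambda>n. vdist Y (s n) l) \<longlonglongrightarrow> 0"

definition unit_ball_on :: "'u nspace \<Rightarrow> 'u set" where
  "unit_ball_on Y = {y \<in> carrier Y. vnorm Y y \<le> 1}"

definition type_space :: "'a::real_normed_vector nspace" where
  "type_space = \<lparr>carrier = UNIV, vzero = 0, vadd = (+), vscale = (*\<^sub>R), vnorm = norm\<rparr>"

lemma banach_space_on_type_space: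
  "banach_space_on (type_space :: 'a::banach nspace)"
proof
  fix s :: "nat \<Rightarrow> 'a"
  assume "\<And>e. e > 0 \<Longrightarrow>
    \<exists>N. \<forall>m\<ge>N. \<forall>n\<ge>N. vdist type_space (s m) (s n) < e"
  then have "Cauchy s"
    by (simp add: Cauchy_iff vdist_def type_space_def)
  then obtain l where "s \<longlonglongrightarrow> l"
    using Cauchy_convergent convergent_def by blast
  then have "(\<lambda>n. vdist type_space (s n) l) \<longlonglongrightarrow> 0"
    by (simp add: vdist_def type_space_def LIM_zero tendsto_norm_zero)
  then show "\<exists>l\<in>carrier type_space. (\<lambda>n. vdist type_space (s n) l) \<longlonglongrightarrow> 0"
    by (auto simp: type_space_def)
qed (auto simp: type_space_def algebra_simps norm_triangle_ineq)

text \<open>Every function on the discrete space \<^typ>\<open>nat\<close> is continuous, and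
  \<^typ>\<open>nat \<Rightarrow>\<^sub>C real\<close> carries the supremum norm.\<close>

definition ell_infinity :: "(nat \<Rightarrow>\<^sub>C real) nspace" where
  "ell_infinity = type_space"


section \<open>Operators, dual spaces and adjoints\<close>

definition operator_into :: "'u nspace \<Rightarrow> ('x::real_normed_vector \<Rightarrow> 'u) \<Rightarrow> bool" where
  "operator_into Y T \<longleftrightarrow>
     range T \<subseteq> carrier Y \<and>
     (\<forall>x y. T (x + y) = vadd Y (T x) (T y)) \<and>
     (\<forall>a x. T (a *\<^sub>R x) = vscale Y a (T x)) \<and>
     (\<exists>K. \<forall>x. vnorm Y (T x) \<le> K * norm x)"

definition functional_on :: "'u nspace \<Rightarrow> ('u \<Rightarrow> real) \<Rightarrow> bool" where
  "functional_on Y f \<longleftrightarrow>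
     (\<forall>x\<in>carrier Y. \<forall>y\<in>carrier Y. f (vadd Y x y) = f x + f y) \<and>
     (\<forall>a. \<forall>x\<in>carrier Y. f (vscale Y a x) = a * f x) \<and>
     (\<exists>K. \<forall>x\<in>carrier Y. \<bar>f x\<bar> \<le> K * vnorm Y x)"

text \<open>Functionals are made extensional so that each has a unique representative. The norm is the
  analogue of \<^const>\<open>onorm\<close>; the zero vector contributes \<open>0 / 0 = 0\<close>.\<close>

definition dual_on :: "'u nspace \<Rightarrow> ('u \<Rightarrow> real) nspace" where
  "dual_on Y = \<lparr>
     carrier = {f. functional_on Y f \<and> f \<in> extensional (carrier Y)},
     vzero = restrict (\<lambda>y. 0) (carrier Y),
     vadd = (\<lambda>f g. restrict (\<lambda>y. f y + g y) (carrier Y)),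
     vscale = (\<lambda>a f. restrict (\<lambda>y. a * f y) (carrier Y)),
     vnorm = (\<lambda>f. SUP y\<in>carrier Y. \<bar>f y\<bar> / vnorm Y y)\<rparr>"

lemma carrier_dual_on_type_space: "f \<in> carrier (dual_on type_space) \<longleftrightarrow> bounded_linear f"
proof -
  have "bounded_linear f \<longleftrightarrow> (\<forall>x y. f (x + y) = f x + f y) \<and>
      (\<forall>a x. f (a *\<^sub>R x) = a * f x) \<and> (\<exists>K. \<forall>x. \<bar>f x\<bar> \<le> K * norm x)"
    by (auto simp: bounded_linear_def bounded_linear_axioms_def linear_iff mult.commute)
  then show ?thesis
    by (simp add: dual_on_def functional_on_def type_space_def)
qed

lemma vnorm_dual_on_type_space: "vnorm (dual_on type_space) f = onorm f"
  by (simp add: dual_on_def type_space_def onorm_def)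

definition adjoint_into :: "('x::real_normed_vector \<Rightarrow> 'u) \<Rightarrow> ('u \<Rightarrow> real) \<Rightarrow> ('x \<Rightarrow>\<^sub>L real)" where
  "adjoint_into T f = Blinfun (\<lambda>x. f (T x))"


section \<open>Weak topology and compactness properties\<close>

definition weak_topology :: "'a::real_normed_vector topology" where
  "weak_topology = pullback_topology UNIV (\<lambda>x (f :: 'a \<Rightarrow>\<^sub>L real). blinfun_apply f x) euclidean"

definition weakly_Cauchy :: "(nat \<Rightarrow> 'a::real_normed_vector) \<Rightarrow> bool" where
  "weakly_Cauchy s \<longleftrightarrow> (\<forall>f :: 'a \<Rightarrow>\<^sub>L real. Cauchy (\<lambda>n. blinfun_apply f (s n)))"

definition weakly_precompact :: "'a::real_normed_vector set \<Rightarrow> bool" where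
  "weakly_precompact S \<longleftrightarrow>
     (\<forall>s :: nat \<Rightarrow> 'a. range s \<subseteq> S \<longrightarrow> (\<exists>r :: nat \<Rightarrow> nat. strict_mono r \<and> weakly_Cauchy (s \<circ> r)))"

definition relatively_weakly_compact :: "'a::real_normed_vector set \<Rightarrow> bool" where
  "relatively_weakly_compact S \<longleftrightarrow> compactin weak_topology (weak_topology closure_of S)"

definition relatively_compact :: "'a::real_normed_vector set \<Rightarrow> bool" where
  "relatively_compact S \<longleftrightarrow> compact (closure S)"

definition weakly_precompact_operator ::
    "'w nspace \<Rightarrow> ('w \<Rightarrow> 'a::real_normed_vector) \<Rightarrow> bool" where
  "weakly_precompact_operator W S \<longleftrightarrow> weakly_precompact (S ` unit_ball_on W)"

definition weakly_compact_operator ::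
    "'w nspace \<Rightarrow> ('w \<Rightarrow> 'a::real_normed_vector) \<Rightarrow> bool" where
  "weakly_compact_operator W S \<longleftrightarrow> relatively_weakly_compact (S ` unit_ball_on W)"

definition compact_operator ::
    "'w nspace \<Rightarrow> ('w \<Rightarrow> 'a::real_normed_vector) \<Rightarrow> bool" where
  "compact_operator W S \<longleftrightarrow> relatively_compact (S ` unit_ball_on W)"


section \<open>Weakly p-summable sequences\<close>

definition weakly_p_summable :: "real \<Rightarrow> (nat \<Rightarrow> 'a::real_normed_vector) \<Rightarrow> bool" where
  "weakly_p_summable p x \<longleftrightarrow>
     (\<forall>f :: 'a \<Rightarrow>\<^sub>L real. summable (\<lambda>n. \<bar>blinfun_apply f (x n)\<bar> powr p))"

definition p_convergent :: "real \<Rightarrow> 'u nspace \<Rightarrow> ('x::real_normed_vector \<Rightarrow> 'u) \<Rightarrow> bool" where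
  "p_convergent p Y T \<longleftrightarrow>
     (\<forall>x. weakly_p_summable p x \<longrightarrow> (\<lambda>n. vnorm Y (T (x n))) \<longlonglongrightarrow> 0)"

text \<open>The supremum is taken in \<^typ>\<open>ennreal\<close> so that it is \<open>0\<close> for the empty set, whereas
  \<open>Sup {}\<close> is unspecified on the reals.\<close>

definition weakly_p_L_set :: "real \<Rightarrow> ('x::real_normed_vector \<Rightarrow>\<^sub>L real) set \<Rightarrow> bool" where
  "weakly_p_L_set p A \<longleftrightarrow> bounded A \<and>
     (\<forall>x. weakly_p_summable p x \<longrightarrow>
        (\<lambda>n. SUP f\<in>A. ennreal \<bar>blinfun_apply f (x n)\<bar>) \<longlonglongrightarrow> 0)"

end

theory Submission
  imports Defs
begin

text \<open>
  The adjoint of a \<open>p\<close>-convergent operator maps the unit ball to a weakly-\<open>p\<close>-\<open>L\<close>-set, because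
  \<open>\<bar>T\<^sup>* f (x\<^sub>n)\<bar> \<le> \<parallel>T x\<^sub>n\<parallel>\<close>. Conversely, a sequence \<open>(s\<^sub>n)\<close> in a weakly-\<open>p\<close>-\<open>L\<close>-set consists of images of
  coordinate functionals under the adjoint of the \<open>p\<close>-convergent operator \<open>x \<mapsto> (s\<^sub>n x)\<^sub>n\<close> into
  \<open>\<ell>\<^sub>\<infinity>\<close>. It remains to see that each compactness property passes from the sequences of a bounded
  subset of \<open>X\<^sup>*\<close> to the whole set. Only weak compactness is not immediate; there it is the hard
  half of the Eberlein--Smulian theorem, proved by a double limit argument.
\<close>

section \<open>Weak compactness in dual spaces\<close>

text \<open>Minimises the sum \<open>q\<close> of the squared errors over the ball of radius \<open>norm \<phi>\<close>. At a near-minimiser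
  \<open>x\<close> the functional \<open>g0\<close>, the combination of the \<open>g\<close> weighted by their errors, almost attains its
  supremum over the ball, and comparison with \<open>\<phi> g0\<close> forces \<open>q x\<close> to be small. This replaces
  the usual separation theorem in \<open>\<real>\<^sup>n\<close>.\<close>

lemma helly_approximation:
  fixes \<phi> :: "('a::real_normed_vector \<Rightarrow>\<^sub>L real) \<Rightarrow>\<^sub>L real"
  assumes "finite G" and "0 < e"
  shows "\<exists>x. norm x \<le> norm \<phi> \<and> (\<forall>g\<in>G. \<bar>blinfun_apply g x - blinfun_apply \<phi> g\<bar> < e)"
proof -
  define r where "r = norm \<phi>"
  have r: "0 \<le> r" by (simp add: r_def)
  define v where "v g x = blinfun_apply \<phi> g - blinfun_apply g x" for g x
  define q where "q x = (\<Sum>g\<in>G. (v g x)\<^sup>2)" for x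
  define D where "D = Inf (q ` cball 0 r)"
  \<comment> \<open>Bounds the second-order term below: a functional \<open>g\<close> differs by at
    most \<open>2 * r * norm g\<close> at two points of the ball.\<close>
  define M where "M = (\<Sum>g\<in>G. (2 * r * norm g)\<^sup>2)"
  have q_nonneg: "0 \<le> q x" for x
    by (simp add: q_def sum_nonneg)
  have M_nonneg: "0 \<le> M"
    by (simp add: M_def sum_nonneg)
  have bdd: "bdd_below (q ` cball 0 r)"
    by (rule bdd_belowI[of _ 0]) (auto simp: q_nonneg)
  have D_le: "D \<le> q x" if "norm x \<le> r" for x
    unfolding D_def using that by (intro cINF_lower[OF bdd]) simp
  have near: "\<exists>x. norm x \<le> r \<and> q x < D + \<eta>" if "0 < \<eta>" for \<eta>
  proof -
    have ne: "q ` cball 0 r \<noteq> {}" using r by simp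
    have "Inf (q ` cball 0 r) < D + \<eta>" using that by (simp add: D_def)
    from cInf_lessD[OF ne this] show ?thesis by auto
  qed
  have "D \<le> 0"
  proof (rule ccontr)
    assume "\<not> D \<le> 0"
    then have D: "0 < D" by simp
    \<comment> \<open>The step length. Since \<open>s \<le> 1\<close>, the segment from
      \<open>x\<close> to \<open>y\<close> stays in the ball. The slack \<open>s\<^sup>2\<close> of
      the near-minimiser and the quadratic term \<open>s\<^sup>2 * M\<close> are both of second
      order, so dividing by \<open>s\<close> leaves an error of at most \<open>D\<close>.\<close>
    define s where "s = min 1 (D / (1 + M))"
    have s: "0 < s" "s \<le> 1"
      using D M_nonneg by (auto simp: s_def)
    have sM: "s * (1 + M) \<le> D"
      using M_nonneg pos_le_divide_eq[of "1 + M" s D] by (simp add: s_def)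
    obtain x where x: "norm x \<le> r" "q x < D + s\<^sup>2"
      using near[of "s\<^sup>2"] s by auto
    define g0 where "g0 = (\<Sum>g\<in>G. v g x *\<^sub>R g)"
    have g0_apply: "blinfun_apply g0 y = (\<Sum>g\<in>G. v g x * blinfun_apply g y)" for y
      by (simp add: g0_def blinfun.sum_left blinfun.scaleR_left)
    let ?B = "blinfun_apply g0 x + s * (1 + M) / 2"
    have *: "blinfun_apply g0 y \<le> ?B" if y: "norm y \<le> r" for y
    proof -
      define z where "z = (1 - s) *\<^sub>R x + s *\<^sub>R y"
      have "norm z \<le> (1 - s) * norm x + s * norm y"
        unfolding z_def using s norm_triangle_ineq[of "(1 - s) *\<^sub>R x" "s *\<^sub>R y"] by simp
      also have "\<dots> \<le> (1 - s) * r + s * r"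
        using x y s by (intro add_mono mult_left_mono) auto
      finally have "norm z \<le> r" by (simp add: algebra_simps)
      then have "D \<le> q z" by (rule D_le)
      also have "q z = (\<Sum>g\<in>G. (v g x)\<^sup>2 - 2 * s * (v g x * (blinfun_apply g y - blinfun_apply g x))
          + s\<^sup>2 * (blinfun_apply g y - blinfun_apply g x)\<^sup>2)"
      proof -
        have vz: "v g z = v g x - s * (blinfun_apply g y - blinfun_apply g x)" for g
          unfolding v_def z_def blinfun.add_right blinfun.scaleR_right by (simp add: algebra_simps)
        then show ?thesis
          unfolding q_def vz power2_eq_square by (intro sum.cong) (auto simp: algebra_simps)
      qed
      also have "\<dots> = q x - 2 * s * (g0 y - g0 x) + s\<^sup>2 * (\<Sum>g\<in>G. (blinfun_apply g y - blinfun_apply g x)\<^sup>2)"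
        by (simp add: q_def g0_apply sum.distrib sum_subtractf sum_distrib_left algebra_simps)
      also have "\<dots> \<le> q x - 2 * s * (g0 y - g0 x) + s\<^sup>2 * M"
      proof -
        have "(g y - g x)\<^sup>2 \<le> (2 * r * norm g)\<^sup>2" for g :: "'a \<Rightarrow>\<^sub>L real"
        proof -
          have "\<bar>g (y - x)\<bar> \<le> norm g * norm (y - x)"
            using norm_blinfun[of g "y - x"] by simp
          also have "\<dots> \<le> norm g * (2 * r)"
            using x y norm_triangle_ineq4[of y x] by (intro mult_left_mono) auto
          finally show ?thesis
            by (intro iffD1[OF abs_le_square_iff]) (use r in \<open>simp add: blinfun.diff_right algebra_simps\<close>)
        qed
        then show ?thesis
          unfolding M_def by (intro add_left_mono mult_left_mono sum_mono) auto
      qed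
      finally have "2 * s * (g0 y - g0 x) \<le> s * (s * (1 + M))"
        using x by (simp add: power2_eq_square algebra_simps)
      then have "2 * (g0 y - g0 x) \<le> s * (1 + M)"
        using s(1) mult_le_cancel_left_pos[of s "2 * (g0 y - g0 x)" "s * (1 + M)"]
        by (simp add: mult.assoc mult.left_commute)
      then show ?thesis by simp
    qed
    have B0: "0 \<le> ?B" using *[of 0] r by simp
    have "r * norm g0 \<le> ?B"
    proof (cases "r = 0")
      case False
      with r have r0: "0 < r" by simp
      have "norm g0 \<le> ?B / r"
      proof (rule norm_blinfun_bound)
        fix y
        show "norm (blinfun_apply g0 y) \<le> ?B / r * norm y"
        proof (cases "y = 0")
          case False
          \<comment> \<open>Rescaling \<open>y\<close> to norm \<open>r\<close> with either sign
            turns the one-sided bound on the ball into a bound for \<open>norm g0\<close>.\<close>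
          have "c * (r / norm y * blinfun_apply g0 y) \<le> ?B" if "\<bar>c\<bar> = 1" for c
            using *[of "(c * (r / norm y)) *\<^sub>R y"] that False r0
            by (simp add: blinfun.scaleR_right abs_mult)
          from this[of 1] this[of "-1"] have "r / norm y * \<bar>blinfun_apply g0 y\<bar> \<le> ?B"
            by (cases "0 \<le> blinfun_apply g0 y") simp_all
          then show ?thesis using False r0 by (simp add: field_simps)
        qed simp
      qed (use r0 B0 in simp)
      then show ?thesis using r0 by (simp add: field_simps)
    qed (use B0 in simp)
    moreover have "blinfun_apply \<phi> g0 \<le> r * norm g0"
      using norm_blinfun[of \<phi> g0] by (simp add: r_def)
    \<comment> \<open>The weights of \<open>g0\<close> are the errors themselves, so the error at
      \<open>g0\<close> is the sum of their squares. This yields \<open>q x \<le> D / 2\<close>,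
      against \<open>D \<le> q x\<close>.\<close>
    moreover have "blinfun_apply \<phi> g0 - blinfun_apply g0 x = q x"
    proof -
      have "blinfun_apply \<phi> g0 = (\<Sum>g\<in>G. v g x * blinfun_apply \<phi> g)"
        by (simp add: g0_def blinfun.sum_right blinfun.scaleR_right)
      then have "blinfun_apply \<phi> g0 - blinfun_apply g0 x
          = (\<Sum>g\<in>G. v g x * (blinfun_apply \<phi> g - blinfun_apply g x))"
        by (simp add: g0_apply sum_subtractf right_diff_distrib)
      then show ?thesis
        by (simp add: q_def v_def power2_eq_square)
    qed
    ultimately have "q x \<le> s * (1 + M) / 2" by linarith
    with D_le[OF x(1)] sM D show False by linarith
  qed
  then obtain x where x: "norm x \<le> r" "q x < e\<^sup>2"
    using near[of "e\<^sup>2"] \<open>0 < e\<close> by force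
  have "\<bar>blinfun_apply g x - blinfun_apply \<phi> g\<bar> < e" if "g \<in> G" for g
  proof -
    have "(v g x)\<^sup>2 \<le> q x"
      unfolding q_def using \<open>finite G\<close> that by (intro member_le_sum) auto
    with x have "(v g x)\<^sup>2 < e\<^sup>2" by simp
    then have "\<bar>v g x\<bar> < e" using \<open>0 < e\<close> power2_less_imp_less[of "\<bar>v g x\<bar>" e] by simp
    then show ?thesis by (simp add: v_def abs_minus_commute)
  qed
  with x show ?thesis by (auto simp: r_def)
qed

section \<open>Cluster points in the topology of pointwise convergence\<close>

lemma open_coordinate_box:
  fixes k :: "'i \<Rightarrow> real"
  assumes "finite I"
  shows "open {h. \<forall>i\<in>I. \<bar>h i - k i\<bar> < e}"
proof -
  have "open {h :: 'i \<Rightarrow> real. \<bar>h i - k i\<bar> < e}" for i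
    by (intro open_Collect_less continuous_intros) auto
  moreover have "{h. \<forall>i\<in>I. \<bar>h i - k i\<bar> < e} = (\<Inter>i\<in>I. {h. \<bar>h i - k i\<bar> < e})"
    by auto
  ultimately show ?thesis
    using assms by (metis (no_types, lifting) open_INT)
qed

lemma closure_coordinates_approx:
  fixes k :: "'i \<Rightarrow> real"
  assumes "k \<in> closure S" and "finite I" and "0 < e"
  shows "\<exists>h\<in>S. \<forall>i\<in>I. \<bar>h i - k i\<bar> < e"
proof -
  have "k \<in> {h. \<forall>i\<in>I. \<bar>h i - k i\<bar> < e}"
    using \<open>0 < e\<close> by simp
  then show ?thesis
    using assms(1) open_coordinate_box[OF \<open>finite I\<close>, of k e]
    unfolding closure_iff_nhds_not_empty by blast
qed

lemma cluster_point_eq_limit: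
  fixes u :: "nat \<Rightarrow> real"
  assumes "u \<longlonglongrightarrow> l" and cluster: "\<And>e N. 0 < e \<Longrightarrow> \<exists>n\<ge>N. \<bar>u n - k\<bar> < e"
  shows "k = l"
proof (rule ccontr)
  assume "k \<noteq> l"
  define e where "e = \<bar>k - l\<bar> / 2"
  have e: "0 < e" "\<bar>k - l\<bar> = 2 * e"
    using \<open>k \<noteq> l\<close> by (auto simp: e_def)
  obtain N where N: "\<And>n. n \<ge> N \<Longrightarrow> \<bar>u n - l\<bar> < e"
    using LIMSEQ_D[OF assms(1) e(1)] by auto
  obtain n where n: "n \<ge> N" "\<bar>u n - k\<bar> < e"
    using cluster[OF e(1)] by blast
  show False
    using n(2) N[OF n(1)] e(2) by linarith
qed

text \<open>Compactness of a set of functions on an arbitrary index set need not give convergent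
  subsequences, so \<open>k\<close> is only a cluster point. Each \<open>k i\<close> is then a
  cluster value of the \<open>i\<close>-th coordinates, hence their limit whenever they
  converge.\<close>

lemma compact_coordinatewise_limit:
  fixes s :: "nat \<Rightarrow> 'i \<Rightarrow> real"
  assumes "compact K" and "\<And>n. s n \<in> K"
  obtains k where "k \<in> K" and "\<And>i l. (\<lambda>n. s n i) \<longlonglongrightarrow> l \<Longrightarrow> k i = l"
proof -
  let ?F = "filtermap s sequentially"
  have "?F \<noteq> bot" by (simp add: filtermap_bot_iff)
  moreover have "eventually (\<lambda>h. h \<in> K) ?F"
    using assms(2) by (simp add: eventually_filtermap)
  ultimately obtain k where k: "k \<in> K" "inf (nhds k) ?F \<noteq> bot"
    using \<open>compact K\<close> unfolding compact_filter by blast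
  have "\<exists>n\<ge>N. \<bar>s n i - k i\<bar> < e" if "0 < e" for i e N
  proof (rule ccontr)
    let ?U = "{h. \<forall>j\<in>{i}. \<bar>h j - k j\<bar> < e}"
    assume "\<not> ?thesis"
    then have "eventually (\<lambda>h. h \<notin> ?U) ?F"
      by (auto simp: eventually_filtermap eventually_sequentially)
    moreover have "eventually (\<lambda>h. h \<in> ?U) (nhds k)"
      using open_coordinate_box[of "{i}" k e] \<open>0 < e\<close>
      by (intro eventually_nhds_in_open) auto
    ultimately have "eventually (\<lambda>h. False) (inf (nhds k) ?F)"
      unfolding eventually_inf by blast
    with k(2) show False by (simp add: trivial_limit_def)
  qed
  then show thesis
    using k(1) by (intro that[of k] cluster_point_eq_limit)
qed

section \<open>Dual balls and the weak topology inside the product topology\<close>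

text \<open>Its members are plain functions, so the weak-star topology is the product topology of
  the function type.\<close>

definition dual_ball :: "real \<Rightarrow> ('a::real_normed_vector \<Rightarrow> real) set" where
  "dual_ball C = {\<Phi>. (\<forall>x y. \<Phi> (x + y) = \<Phi> x + \<Phi> y) \<and> (\<forall>c x. \<Phi> (c *\<^sub>R x) = c * \<Phi> x) \<and>
     (\<forall>x. \<bar>\<Phi> x\<bar> \<le> C * norm x)}"

lemma dual_ball_bounded_linear: "\<Phi> \<in> dual_ball C \<Longrightarrow> bounded_linear \<Phi>"
  by (intro bounded_linear_intro[where K = C]) (auto simp: dual_ball_def mult.commute)

lemma closed_dual_ball: "closed (dual_ball C :: ('a::real_normed_vector \<Rightarrow> real) set)"
  unfolding dual_ball_def
  by (intro closed_Collect_conj closed_Collect_all closed_Collect_eq closed_Collect_le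
      continuous_intros) auto

text \<open>Banach-Alaoglu: the ball is a closed subset of a product of compact intervals.\<close>

lemma compact_dual_ball: "compact (dual_ball C :: ('a::real_normed_vector \<Rightarrow> real) set)"
proof -
  let ?P = "PiE UNIV (\<lambda>x::'a. {- (C * norm x)..C * norm x})"
  have "compact ?P"
    using compactin_PiE[of "\<lambda>_. euclidean :: real topology" UNIV "\<lambda>x::'a. {- (C * norm x)..C * norm x}"]
    by (simp add: euclidean_product_topology)
  moreover have "dual_ball C \<subseteq> ?P"
    by (auto simp: dual_ball_def abs_le_iff minus_le_iff)
  ultimately show ?thesis
    using compact_Int_closed[OF _ closed_dual_ball, of ?P C] by (simp add: inf.absorb2)
qed

text \<open>The canonical embedding into the bidual, with values in the product space so that
  closures may contain points outside its range.\<close>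

definition evaluation :: "'a::real_normed_vector \<Rightarrow> ('a \<Rightarrow>\<^sub>L real) \<Rightarrow> real" where
  "evaluation x f = blinfun_apply f x"

lemma evaluation_in_dual_ball:
  assumes "norm x \<le> C"
  shows "evaluation x \<in> dual_ball C"
proof -
  have "\<bar>blinfun_apply f x\<bar> \<le> C * norm f" for f
  proof -
    have "\<bar>blinfun_apply f x\<bar> \<le> norm f * norm x"
      using norm_blinfun[of f x] by simp
    also have "\<dots> \<le> norm f * C"
      using assms by (intro mult_left_mono) auto
    finally show ?thesis by (simp add: mult.commute)
  qed
  then show ?thesis
    by (simp add: dual_ball_def evaluation_def blinfun.add_left blinfun.scaleR_left)
qed

lemma openin_weak_topology:
  "openin weak_topology U \<longleftrightarrow> (\<exists>V. open V \<and> U = evaluation -` V)"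
  by (simp add: weak_topology_def openin_pullback_topology evaluation_def[abs_def])

lemma topspace_weak_topology [simp]: "topspace weak_topology = UNIV"
  by (simp add: weak_topology_def topspace_pullback_topology)

lemma continuous_map_evaluation: "continuous_map weak_topology euclidean evaluation"
  by (auto simp: continuous_map_def openin_weak_topology vimage_def)

text \<open>Weakly open sets are exactly the preimages of open sets under \<open>evaluation\<close>,
  so a weakly open cover comes from an open cover of the image.\<close>

lemma compactin_weak_topology_iff:
  "compactin weak_topology K \<longleftrightarrow> compact (evaluation ` K)"
proof
  assume "compactin weak_topology K"
  then show "compact (evaluation ` K)"
    using image_compactin[OF _ continuous_map_evaluation] by simp
next
  assume K: "compact (evaluation ` K)"
  show "compactin weak_topology K"
    unfolding compactin_def
  proof (intro conjI allI impI)
    fix \<U> :: "'a set set"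
    assume \<U>: "Ball \<U> (openin weak_topology) \<and> K \<subseteq> \<Union>\<U>"
    let ?\<V> = "{V. open V \<and> evaluation -` V \<in> \<U>}"
    have "evaluation ` K \<subseteq> \<Union>?\<V>"
    proof
      fix h assume "h \<in> evaluation ` K"
      then obtain x U where "h = evaluation x" "x \<in> U" "U \<in> \<U>" using \<U> by blast
      moreover then obtain V where "open V" "U = evaluation -` V"
        using \<U> openin_weak_topology by blast
      ultimately show "h \<in> \<Union>?\<V>" by auto
    qed
    then obtain \<W> where \<W>: "\<W> \<subseteq> ?\<V>" "finite \<W>" "evaluation ` K \<subseteq> \<Union>\<W>"
      using K unfolding compact_eq_Heine_Borel by (metis (no_types, lifting) mem_Collect_eq)
    then show "\<exists>\<F>. finite \<F> \<and> \<F> \<subseteq> \<U> \<and> K \<subseteq> \<Union>\<F>"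
      by (intro exI[of _ "(\<lambda>V. evaluation -` V) ` \<W>"]) blast
  qed simp
qed

lemma weak_closure_eq: "weak_topology closure_of S = evaluation -` closure (evaluation ` S)"
proof -
  have "x \<in> weak_topology closure_of S \<longleftrightarrow> evaluation x \<in> euclidean closure_of (evaluation ` S)" for x
  proof -
    have "x \<in> weak_topology closure_of S \<longleftrightarrow>
        (\<forall>V. evaluation x \<in> V \<and> open V \<longrightarrow> (\<exists>y\<in>S. evaluation y \<in> V))"
      unfolding in_closure_of openin_weak_topology topspace_weak_topology by (metis UNIV_I vimage_eq)
    also have "\<dots> \<longleftrightarrow> evaluation x \<in> euclidean closure_of (evaluation ` S)"
      unfolding in_closure_of by auto
    finally show ?thesis .
  qed
  then show ?thesis by auto
qed

lemma relatively_weakly_compact_subset: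
  assumes "relatively_weakly_compact T" and "S \<subseteq> T"
  shows "relatively_weakly_compact S"
  unfolding relatively_weakly_compact_def
  by (rule closed_compactin[OF assms(1)[unfolded relatively_weakly_compact_def]
        closure_of_mono[OF assms(2)] closedin_closure_of])

lemma relatively_weakly_compact_sequence_limit:
  fixes s :: "nat \<Rightarrow> 'a::real_normed_vector"
  assumes "relatively_weakly_compact (range s)"
  obtains a where "\<And>\<phi> :: 'a \<Rightarrow>\<^sub>L real. \<And>l. (\<lambda>n. blinfun_apply \<phi> (s n)) \<longlonglongrightarrow> l \<Longrightarrow> blinfun_apply \<phi> a = l"
proof -
  let ?K = "evaluation ` (weak_topology closure_of (range s))"
  have K: "compact ?K"
    using assms by (simp add: relatively_weakly_compact_def compactin_weak_topology_iff)
  have s: "evaluation (s n) \<in> ?K" for n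
    using closure_subset[of "evaluation ` range s"] by (auto simp: weak_closure_eq)
  obtain k where k: "k \<in> ?K" "\<And>\<phi> l. (\<lambda>n. evaluation (s n) \<phi>) \<longlonglongrightarrow> l \<Longrightarrow> k \<phi> = l"
    using compact_coordinatewise_limit[of ?K "\<lambda>n. evaluation (s n)", OF K s] by metis
  then obtain a where "k = evaluation a" by blast
  with k(2) show thesis
    by (intro that[of a]) (simp add: evaluation_def)
qed

text \<open>A weak-star cluster point in the bidual, which exists by Banach-Alaoglu for every
  bounded sequence.\<close>

lemma bounded_sequence_bidual_limit:
  fixes x :: "nat \<Rightarrow> 'a::real_normed_vector"
  assumes "\<And>n. norm (x n) \<le> C"
  obtains \<psi> :: "('a \<Rightarrow>\<^sub>L real) \<Rightarrow>\<^sub>L real"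
    where "\<And>g l. (\<lambda>n. blinfun_apply g (x n)) \<longlonglongrightarrow> l \<Longrightarrow> blinfun_apply \<psi> g = l"
proof -
  have "evaluation (x n) \<in> dual_ball C" for n
    using assms by (rule evaluation_in_dual_ball)
  then obtain k where k: "k \<in> dual_ball C"
    and *: "\<And>g l. (\<lambda>n. evaluation (x n) g) \<longlonglongrightarrow> l \<Longrightarrow> k g = l"
    using compact_coordinatewise_limit[OF compact_dual_ball, of "\<lambda>n. evaluation (x n)" C] by metis
  have "blinfun_apply (Blinfun k) = k"
    using dual_ball_bounded_linear[OF k] by (rule bounded_linear_Blinfun_apply)
  with * show thesis
    by (intro that[of "Blinfun k"]) (simp add: evaluation_def)
qed

section \<open>The double limit argument\<close>

lemma LIMSEQ_of_inverse_Suc_bound: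
  fixes u :: "nat \<Rightarrow> real"
  assumes "\<And>n. n \<ge> N \<Longrightarrow> \<bar>u n - l\<bar> < inverse (real (Suc n))"
  shows "u \<longlonglongrightarrow> l"
proof -
  have "(\<lambda>n. u n - l) \<longlonglongrightarrow> 0"
    by (rule tendsto_0_le[OF LIMSEQ_inverse_real_of_nat, of _ 1])
      (use assms in \<open>force simp: eventually_sequentially intro: less_imp_le\<close>)
  then show ?thesis by (simp add: LIM_zero_iff)
qed

text \<open>A point \<open>\<Phi>\<close> of the pointwise closure of \<open>A\<close> restricts to a functional \<open>f\<close> on the predual. To see
  that \<open>\<Phi> \<phi> = \<phi> f\<close>, choose \<open>a\<^sub>n\<close> and \<open>x\<^sub>n\<close> alternately, so that \<open>a\<^sub>n (x\<^sub>m)\<close> tends to \<open>f (x\<^sub>m)\<close>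
  as \<open>n\<close> grows and to \<open>\<phi> (a\<^sub>n)\<close> as \<open>m\<close> grows. If \<open>b\<close> and \<open>\<psi>\<close> are cluster points of the two sequences,
  then the two iterated limits are both equal to \<open>\<psi> b\<close>.\<close>

lemma dual_relatively_weakly_compactI:
  fixes A :: "('a::real_normed_vector \<Rightarrow>\<^sub>L real) set"
  assumes bounded: "bounded A"
    and seq: "\<And>s :: nat \<Rightarrow> 'a \<Rightarrow>\<^sub>L real. range s \<subseteq> A \<Longrightarrow> relatively_weakly_compact (range s)"
  shows "relatively_weakly_compact A"
proof -
  obtain C where C: "\<And>a. a \<in> A \<Longrightarrow> norm a \<le> C"
    using bounded by (auto simp: bounded_iff)
  then have "evaluation ` A \<subseteq> dual_ball C"
    by (auto intro: evaluation_in_dual_ball)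
  then have sub: "closure (evaluation ` A) \<subseteq> dual_ball C"
    by (intro closure_minimal closed_dual_ball)
  \<comment> \<open>This suffices: the closure lies in a compact dual ball, and once it consists of
    evaluations it is the image of the weak closure of \<open>A\<close>.\<close>
  have "closure (evaluation ` A) \<subseteq> range evaluation"
  proof
    fix \<Phi> assume \<Phi>: "\<Phi> \<in> closure (evaluation ` A)"
    have bl: "bounded_linear \<Phi>"
      using \<Phi> sub by (intro dual_ball_bounded_linear) auto
    \<comment> \<open>The canonical embedding of the predual into its bidual; \<open>f\<close> is
      the restriction of \<open>\<Phi>\<close> along it.\<close>
    define J :: "'a \<Rightarrow> ('a \<Rightarrow>\<^sub>L real) \<Rightarrow>\<^sub>L real" where "J x = Blinfun (\<lambda>g. blinfun_apply g x)" for x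
    have J: "blinfun_apply (J x) g = blinfun_apply g x" for x g
      by (simp add: J_def bounded_linear_Blinfun_apply blinfun.bounded_linear_left)
    have J_lin: "J (x + y) = J x + J y" "J (c *\<^sub>R x) = c *\<^sub>R J x" for x y c
      by (auto intro!: blinfun_eqI simp: J blinfun.add_left blinfun.add_right blinfun.scaleR_left
          blinfun.scaleR_right)
    have J_norm: "norm (J x) \<le> 1 * norm x" for x
    proof (rule norm_blinfun_bound)
      show "norm (blinfun_apply (J x) g) \<le> 1 * norm x * norm g" for g
        using norm_blinfun[of g x] by (simp add: J mult.commute)
    qed simp
    have "bounded_linear J"
      by (rule bounded_linear_intro[where K = 1]) (use J_lin J_norm in auto)
    then have "bounded_linear (\<lambda>x. \<Phi> (J x))"
      by (rule bounded_linear_compose[OF bl])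
    then obtain f :: "'a \<Rightarrow>\<^sub>L real" where f: "\<And>x. blinfun_apply f x = \<Phi> (J x)"
      by (metis bounded_linear_Blinfun_apply)
    have "\<Phi> \<phi> = blinfun_apply \<phi> f" for \<phi>
    proof -
      have "\<exists>x. norm x \<le> norm \<phi> \<and>
          (\<forall>g\<in>G. \<bar>blinfun_apply g x - blinfun_apply \<phi> g\<bar> < inverse (real (Suc n)))"
        if "finite G" for G and n
        using that by (intro helly_approximation) auto
      then obtain X where X: "\<And>G n. finite G \<Longrightarrow> norm (X G n) \<le> norm \<phi> \<and>
          (\<forall>g\<in>G. \<bar>blinfun_apply g (X G n) - blinfun_apply \<phi> g\<bar> < inverse (real (Suc n)))"
        by metis
      have "\<exists>a\<in>A. \<bar>blinfun_apply \<phi> a - \<Phi> \<phi>\<bar> < inverse (real (Suc n)) \<and>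
          (\<forall>x\<in>S. \<bar>blinfun_apply a x - blinfun_apply f x\<bar> < inverse (real (Suc n)))"
        if "finite S" for S and n
        using closure_coordinates_approx[OF \<Phi>, of "insert \<phi> (J ` S)" "inverse (real (Suc n))"] that
        by (simp add: evaluation_def J f)
      then obtain a' where a': "\<And>S n. finite S \<Longrightarrow> a' S n \<in> A \<and>
          \<bar>blinfun_apply \<phi> (a' S n) - \<Phi> \<phi>\<bar> < inverse (real (Suc n)) \<and>
          (\<forall>x\<in>S. \<bar>blinfun_apply (a' S n) x - blinfun_apply f x\<bar> < inverse (real (Suc n)))"
        by metis
      \<comment> \<open>The new functional enters \<open>G\<close> before the new point is chosen.
        Thus \<open>a n\<close> is controlled at \<open>x m\<close> for \<open>m < n\<close>, and
        \<open>x m\<close> is controlled at \<open>a n\<close> for \<open>n \<le> m\<close>; this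
        explains the thresholds \<open>Suc m\<close> and \<open>n\<close> in the limits
        below.\<close>
      define step where "step n = (\<lambda>(G, S). let G' = insert (a' S n) G in (G', insert (X G' n) S))"
        for n
      \<comment> \<open>Putting \<open>f\<close> into the initial set makes every \<open>x n\<close>
        approximate \<open>\<phi>\<close> at \<open>f\<close> as well.\<close>
      define st where "st = rec_nat ({f}, {}) step"
      define G where "G n = fst (st n)" for n
      define S where "S n = snd (st n)" for n
      define a where "a n = a' (S n) n" for n
      define x where "x n = X (G (Suc n)) n" for n
      have G0: "G 0 = {f}" and S0: "S 0 = {}"
        by (simp_all add: G_def S_def st_def)
      have GS: "G (Suc n) = insert (a n) (G n)" for n
        by (simp add: G_def S_def st_def a_def step_def Let_def split_beta)
      have SS: "S (Suc n) = insert (x n) (S n)" for n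
        unfolding x_def by (simp add: G_def S_def st_def step_def Let_def split_beta)
      have fin: "finite (G n)" "finite (S n)" for n
        by (induction n) (auto simp: G0 S0 GS SS)
      have G_mem: "f \<in> G n" "m < n \<Longrightarrow> a m \<in> G n" for m n
        by (induction n) (auto simp: G0 GS less_Suc_eq)
      have S_mem: "m < n \<Longrightarrow> x m \<in> S n" for m n
        by (induction n) (auto simp: SS less_Suc_eq)
      have x_norm: "norm (x n) \<le> norm \<phi>" for n
        using X[OF fin(1)] by (simp add: x_def)
      have lim_xf: "(\<lambda>m. blinfun_apply f (x m)) \<longlonglongrightarrow> blinfun_apply \<phi> f"
        using X[OF fin(1)] G_mem(1) by (intro LIMSEQ_of_inverse_Suc_bound[of 0]) (auto simp: x_def)
      have lim_xa: "(\<lambda>m. blinfun_apply (a n) (x m)) \<longlonglongrightarrow> blinfun_apply \<phi> (a n)" for n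
        using X[OF fin(1)] G_mem(2) by (intro LIMSEQ_of_inverse_Suc_bound[of n]) (auto simp: x_def)
      have lim_ax: "(\<lambda>n. blinfun_apply (a n) (x m)) \<longlonglongrightarrow> blinfun_apply f (x m)" for m
        using a'[OF fin(2)] S_mem
        by (intro LIMSEQ_of_inverse_Suc_bound[of "Suc m"]) (auto simp: a_def)
      have lim_phi: "(\<lambda>n. blinfun_apply \<phi> (a n)) \<longlonglongrightarrow> \<Phi> \<phi>"
        using a'[OF fin(2)] by (intro LIMSEQ_of_inverse_Suc_bound[of 0]) (auto simp: a_def)
      have "range a \<subseteq> A"
        using a'[OF fin(2)] by (auto simp: a_def)
      then obtain b where b_lim: "\<And>\<eta> :: ('a \<Rightarrow>\<^sub>L real) \<Rightarrow>\<^sub>L real. \<And>l.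
          (\<lambda>n. blinfun_apply \<eta> (a n)) \<longlonglongrightarrow> l \<Longrightarrow> blinfun_apply \<eta> b = l"
        using relatively_weakly_compact_sequence_limit[OF seq] by metis
      \<comment> \<open>Evaluation at \<open>x m\<close> is a functional on the dual, so it can test
        the weak cluster point \<open>b\<close>.\<close>
      have bx: "blinfun_apply b (x m) = blinfun_apply f (x m)" for m
        using b_lim[of "J (x m)"] lim_ax by (simp add: J)
      obtain \<psi> :: "('a \<Rightarrow>\<^sub>L real) \<Rightarrow>\<^sub>L real"
        where \<psi>: "\<And>g l. (\<lambda>n. blinfun_apply g (x n)) \<longlonglongrightarrow> l \<Longrightarrow> blinfun_apply \<psi> g = l"
        using bounded_sequence_bidual_limit[of x, OF x_norm] by metis
      have "blinfun_apply \<psi> b = blinfun_apply \<phi> f"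
        using lim_xf by (intro \<psi>) (simp add: bx)
      moreover have "blinfun_apply \<psi> (a n) = blinfun_apply \<phi> (a n)" for n
        by (rule \<psi>[OF lim_xa])
      then have "blinfun_apply \<psi> b = \<Phi> \<phi>"
        using lim_phi by (intro b_lim) simp
      ultimately show ?thesis by simp
    qed
    then have "\<Phi> = evaluation f" by (auto simp: evaluation_def)
    then show "\<Phi> \<in> range evaluation" by blast
  qed
  then have "evaluation ` (weak_topology closure_of A) = closure (evaluation ` A)"
    by (auto simp: weak_closure_eq)
  moreover have "compact (closure (evaluation ` A))"
    using compact_Int_closed[OF compact_dual_ball closed_closure, of C "evaluation ` A"] sub
    by (simp add: inf.absorb2)
  ultimately show ?thesis
    by (simp add: relatively_weakly_compact_def compactin_weak_topology_iff)
qed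

section \<open>Passing from sequences to sets for the other two properties\<close>

text \<open>A sequence in the closure is approximated by one in \<open>A\<close> with errors tending
  to zero; a convergent subsequence of the latter gives one of the former.\<close>

lemma relatively_compact_sequentiallyI:
  fixes A :: "'a::real_normed_vector set"
  assumes seq: "\<And>s :: nat \<Rightarrow> 'a. range s \<subseteq> A \<Longrightarrow> relatively_compact (range s)"
  shows "relatively_compact A"
  unfolding relatively_compact_def compact_def
proof (intro allI impI)
  fix y :: "nat \<Rightarrow> 'a"
  assume y: "\<forall>n. y n \<in> closure A"
  have "\<exists>a\<in>A. dist a (y n) < inverse (real (Suc n))" for n
    using y unfolding closure_approachable by simp
  then obtain a where a: "\<And>n. a n \<in> A" "\<And>n. dist (a n) (y n) < inverse (real (Suc n))"
    by metis
  have "compact (closure (range a))"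
    using seq[of a] a(1) by (auto simp: relatively_compact_def)
  moreover have "a n \<in> closure (range a)" for n
    using closure_subset[of "range a"] by auto
  ultimately obtain l r where r: "strict_mono r" and l: "(a \<circ> r) \<longlonglongrightarrow> l"
    unfolding compact_def by metis
  have "(\<lambda>n. dist (y n) (a n)) \<longlonglongrightarrow> 0"
    by (rule tendsto_0_le[OF LIMSEQ_inverse_real_of_nat, of _ 1])
      (use a(2) in \<open>auto simp: dist_commute intro!: always_eventually less_imp_le\<close>)
  then have "(\<lambda>n. y n - a n) \<longlonglongrightarrow> 0"
    by (simp add: dist_norm tendsto_norm_zero_iff)
  then have "((\<lambda>n. y n - a n) \<circ> r) \<longlonglongrightarrow> 0"
    using r by (rule LIMSEQ_subseq_LIMSEQ)
  from tendsto_add[OF this l] have lim: "(y \<circ> r) \<longlonglongrightarrow> l"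
    by (simp add: o_def)
  moreover have "l \<in> closure A"
    by (rule closed_sequentially[OF closed_closure _ lim]) (use y in auto)
  ultimately show "\<exists>l\<in>closure A. \<exists>r. strict_mono r \<and> (y \<circ> r) \<longlonglongrightarrow> l"
    using r by blast
qed

lemma relatively_compact_subset:
  assumes "relatively_compact T" and "S \<subseteq> T"
  shows "relatively_compact S"
  using compact_Int_closed[of "closure T" "closure S"] closure_mono[OF assms(2)] assms(1)
  by (simp add: relatively_compact_def inf.absorb2)

lemma weakly_precompact_sequentiallyI:
  assumes "\<And>s :: nat \<Rightarrow> _. range s \<subseteq> A \<Longrightarrow> weakly_precompact (range s)"
  shows "weakly_precompact A"
  using assms unfolding weakly_precompact_def by blast

lemma weakly_precompact_subset:
  "weakly_precompact T \<Longrightarrow> S \<subseteq> T \<Longrightarrow> weakly_precompact S"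
  unfolding weakly_precompact_def by blast

section \<open>Adjoints of p-convergent operators\<close>

text \<open>The real supremum in the dual norm dominates its quotients only if they are bounded
  above, which boundedness of \<open>f\<close> ensures. At norm zero the quotient says nothing, and
  the bound by \<open>K\<close> gives \<open>f y = 0\<close>.\<close>

lemma dual_unit_ball_bound:
  assumes "normed_space_on Y" and f: "f \<in> unit_ball_on (dual_on Y)" and y: "y \<in> carrier Y"
  shows "\<bar>f y\<bar> \<le> vnorm Y y"
proof -
  interpret normed_space_on Y by fact
  have "\<exists>K. \<forall>z\<in>carrier Y. \<bar>f z\<bar> \<le> K * vnorm Y z"
    using f by (simp add: unit_ball_on_def dual_on_def functional_on_def)
  then obtain K where K: "\<And>z. z \<in> carrier Y \<Longrightarrow> \<bar>f z\<bar> \<le> K * vnorm Y z"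
    by blast
  have "bdd_above ((\<lambda>z. \<bar>f z\<bar> / vnorm Y z) ` carrier Y)"
  proof (rule bdd_aboveI[of _ "max K 0"], clarify)
    fix z assume "z \<in> carrier Y"
    then have "\<bar>f z\<bar> \<le> max K 0 * vnorm Y z" "0 \<le> vnorm Y z"
      using K[of z] norm_nonneg[of z] mult_right_mono[of K "max K 0" "vnorm Y z"] by auto
    then show "\<bar>f z\<bar> / vnorm Y z \<le> max K 0"
      by (cases "vnorm Y z = 0") (auto simp: divide_le_eq)
  qed
  then have "\<bar>f y\<bar> / vnorm Y y \<le> (SUP z\<in>carrier Y. \<bar>f z\<bar> / vnorm Y z)"
    by (rule cSUP_upper2[OF _ y]) simp
  also have "\<dots> \<le> 1"
    using f by (simp add: unit_ball_on_def dual_on_def)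
  finally show ?thesis
    using K[OF y] norm_nonneg[OF y] by (cases "vnorm Y y = 0") (auto simp: divide_le_eq)
qed

text \<open>\<open>Blinfun\<close> returns the composite only if this is bounded and linear, so that
  has to be checked first.\<close>

lemma adjoint_into_apply:
  assumes "normed_space_on Y" and T: "operator_into Y T" and f: "f \<in> unit_ball_on (dual_on Y)"
  shows "blinfun_apply (adjoint_into T f) x = f (T x)"
proof -
  obtain K where K: "\<And>x. vnorm Y (T x) \<le> K * norm x"
    using T by (auto simp: operator_into_def)
  have cl: "T x \<in> carrier Y" for x
    using T by (auto simp: operator_into_def)
  have "bounded_linear (\<lambda>x. f (T x))"
  proof (rule bounded_linear_intro[where K = K])
    show "norm (f (T x)) \<le> norm x * K" for x
      using dual_unit_ball_bound[OF assms(1) f cl, of x] K[of x] by (simp add: mult.commute)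
  qed (use T f cl in \<open>auto simp: operator_into_def unit_ball_on_def dual_on_def functional_on_def\<close>)
  then show ?thesis
    by (simp add: adjoint_into_def bounded_linear_Blinfun_apply)
qed

lemma weakly_p_L_set_adjoint_unit_ball:
  fixes T :: "'b::real_normed_vector \<Rightarrow> 'u"
  assumes Y: "normed_space_on Y" and T: "operator_into Y T" and conv: "p_convergent p Y T"
  shows "weakly_p_L_set p (adjoint_into T ` unit_ball_on (dual_on Y))"
  unfolding weakly_p_L_set_def
proof (intro conjI allI impI)
  obtain K where K: "\<And>x. vnorm Y (T x) \<le> K * norm x"
    using T by (auto simp: operator_into_def)
  have cl: "T x \<in> carrier Y" for x
    using T by (auto simp: operator_into_def)
  have bound: "\<bar>blinfun_apply (adjoint_into T f) x\<bar> \<le> vnorm Y (T x)"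
    if "f \<in> unit_ball_on (dual_on Y)" for f x
    using dual_unit_ball_bound[OF Y that cl] adjoint_into_apply[OF Y T that] by simp
  have "norm (adjoint_into T f) \<le> max K 0" if "f \<in> unit_ball_on (dual_on Y)" for f
  proof (rule norm_blinfun_bound)
    fix x
    have "\<bar>blinfun_apply (adjoint_into T f) x\<bar> \<le> K * norm x"
      using bound[OF that, of x] K[of x] by linarith
    also have "\<dots> \<le> max K 0 * norm x"
      by (intro mult_right_mono) auto
    finally show "norm (blinfun_apply (adjoint_into T f) x) \<le> max K 0 * norm x" by simp
  qed simp
  then show "bounded (adjoint_into T ` unit_ball_on (dual_on Y))"
    by (auto simp: bounded_iff)
  fix x :: "nat \<Rightarrow> 'b"
  assume "weakly_p_summable p x"
  then have "(\<lambda>n. vnorm Y (T (x n))) \<longlonglongrightarrow> 0"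
    using conv by (simp add: p_convergent_def)
  then have "(\<lambda>n. ennreal (vnorm Y (T (x n)))) \<longlonglongrightarrow> 0"
    using tendsto_ennrealI by fastforce
  then show "(\<lambda>n. SUP f\<in>adjoint_into T ` unit_ball_on (dual_on Y).
      ennreal \<bar>blinfun_apply f (x n)\<bar>) \<longlonglongrightarrow> 0"
    by (rule tendsto_sandwich[OF _ _ tendsto_const, rotated 2])
      (auto intro!: always_eventually SUP_least ennreal_leI bound)
qed

section \<open>Isometric copies of a space in another type\<close>

text \<open>Statement (i) ranges over spaces inside \<open>'u\<close>. To specialise it to
  \<open>ell_infinity\<close>, that space is copied into \<open>'u\<close> with its structure
  carried along \<open>\<iota>\<close>.\<close>

definition transported_space :: "('b::real_normed_vector \<Rightarrow> 'u) \<Rightarrow> 'u nspace" where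
  "transported_space \<iota> = \<lparr>carrier = range \<iota>, vzero = \<iota> 0,
     vadd = (\<lambda>a b. \<iota> (inv \<iota> a + inv \<iota> b)), vscale = (\<lambda>c a. \<iota> (c *\<^sub>R inv \<iota> a)),
     vnorm = (\<lambda>a. norm (inv \<iota> a))\<rparr>"

text \<open>The library has completeness of bounded continuous functions only on metric spaces, and
  \<^typ>\<open>nat\<close> is not an instance of that class.\<close>

lemma convergent_bcontfun:
  fixes t :: "nat \<Rightarrow> 'a::topological_space \<Rightarrow>\<^sub>C 'b::complete_space"
  assumes "Cauchy t"
  shows "convergent t"
proof -
  have "uniformly_Cauchy_on UNIV (\<lambda>n. apply_bcontfun (t n))"
  proof (rule uniformly_Cauchy_onI)
    fix e :: real assume "0 < e"
    then obtain M where "\<forall>m\<ge>M. \<forall>n\<ge>M. dist (t m) (t n) < e"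
      using assms by (auto simp: Cauchy_def)
    then show "\<exists>M. \<forall>x\<in>UNIV. \<forall>m\<ge>M. \<forall>n\<ge>M. dist (apply_bcontfun (t m) x) (apply_bcontfun (t n) x) < e"
      by (meson dist_fun_lt_imp_dist_val_lt)
  qed
  then obtain g where "uniform_limit UNIV (\<lambda>n. apply_bcontfun (t n)) g sequentially"
    using Cauchy_uniformly_convergent uniformly_convergent_on_def by blast
  then obtain l where "t \<longlonglongrightarrow> l"
    by (rule uniform_limit_bcontfunE) auto
  then show ?thesis
    by (auto simp: convergent_def)
qed

lemma banach_space_on_transported_space:
  fixes \<iota> :: "'b::real_normed_vector \<Rightarrow> 'u"
  assumes inj: "inj \<iota>" and complete: "\<And>t :: nat \<Rightarrow> 'b. Cauchy t \<Longrightarrow> convergent t"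
  shows "banach_space_on (transported_space \<iota>)"
proof
  fix s :: "nat \<Rightarrow> 'u"
  assume s: "\<And>n. s n \<in> carrier (transported_space \<iota>)"
    and Cauchy: "\<And>e. e > 0 \<Longrightarrow>
      \<exists>N. \<forall>m\<ge>N. \<forall>n\<ge>N. vdist (transported_space \<iota>) (s m) (s n) < e"
  have "\<forall>n. \<exists>y. s n = \<iota> y"
    using s by (auto simp: transported_space_def)
  then obtain t where t: "\<And>n. s n = \<iota> (t n)" by metis
  have "Cauchy t"
    using Cauchy by (simp add: Cauchy_iff vdist_def transported_space_def t inj)
  then obtain l where "t \<longlonglongrightarrow> l"
    using complete convergent_def by blast
  then have "(\<lambda>n. vdist (transported_space \<iota>) (s n) (\<iota> l)) \<longlonglongrightarrow> 0"
    by (simp add: vdist_def transported_space_def t inj LIM_zero tendsto_norm_zero)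
  then show "\<exists>l\<in>carrier (transported_space \<iota>). (\<lambda>n. vdist (transported_space \<iota>) (s n) l) \<longlonglongrightarrow> 0"
    by (auto simp: transported_space_def)
qed (auto simp: transported_space_def algebra_simps inj norm_triangle_ineq inj_eq)

lemma operator_into_transported_space:
  assumes "inj \<iota>" and "operator_into type_space T"
  shows "operator_into (transported_space \<iota>) (\<lambda>x. \<iota> (T x))"
  using assms by (auto simp: operator_into_def transported_space_def type_space_def)

lemma p_convergent_transported_space:
  assumes "inj \<iota>" and "p_convergent p type_space T"
  shows "p_convergent p (transported_space \<iota>) (\<lambda>x. \<iota> (T x))"
  using assms by (auto simp: p_convergent_def transported_space_def type_space_def)

text \<open>Composing \<open>f\<close> with the inverse of the isometry keeps its norm and gives the
  same adjoint image; restricting makes it extensional. An inclusion is enough, since the three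
  properties pass to subsets.\<close>

lemma adjoint_unit_ball_transported_space:
  assumes inj: "inj \<iota>"
  shows "adjoint_into T ` unit_ball_on (dual_on type_space)
    \<subseteq> adjoint_into (\<lambda>x. \<iota> (T x)) ` unit_ball_on (dual_on (transported_space \<iota>))"
proof clarify
  fix f assume f: "f \<in> unit_ball_on (dual_on (type_space :: 'a nspace))"
  let ?Y = "transported_space \<iota>"
  define g where "g = restrict (\<lambda>y. f (inv \<iota> y)) (range \<iota>)"
  have g: "g (\<iota> y) = f y" for y
    by (simp add: g_def inj)
  have "functional_on ?Y g"
    using f by (auto simp: unit_ball_on_def dual_on_def functional_on_def transported_space_def
        type_space_def g inj)
  moreover have "g \<in> extensional (carrier ?Y)"
    by (simp add: g_def transported_space_def)
  moreover have "vnorm (dual_on ?Y) g = vnorm (dual_on type_space) f"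
    by (simp add: dual_on_def transported_space_def type_space_def image_image g inj)
  ultimately have "g \<in> unit_ball_on (dual_on ?Y)"
    using f by (simp add: unit_ball_on_def) (simp add: dual_on_def)
  moreover have "adjoint_into T f = adjoint_into (\<lambda>x. \<iota> (T x)) g"
    by (simp add: adjoint_into_def g)
  ultimately show "adjoint_into T f \<in> adjoint_into (\<lambda>x. \<iota> (T x)) ` unit_ball_on (dual_on ?Y)"
    by blast
qed

text \<open>For the operator \<open>x \<mapsto> (s\<^sub>n x)\<^sub>n\<close>, the adjoint maps the \<open>n\<close>-th coordinate functional to \<open>s\<^sub>n\<close>.\<close>

lemma weakly_p_L_sequence_as_adjoint:
  fixes s :: "nat \<Rightarrow> 'x::real_normed_vector \<Rightarrow>\<^sub>L real"
  assumes A: "weakly_p_L_set p A" and s: "range s \<subseteq> A"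
  obtains T :: "'x \<Rightarrow> (nat \<Rightarrow>\<^sub>C real)"
  where "operator_into ell_infinity T" and "p_convergent p ell_infinity T"
    and "range s \<subseteq> adjoint_into T ` unit_ball_on (dual_on ell_infinity)"
proof -
  obtain K where K: "\<And>a. a \<in> A \<Longrightarrow> norm a \<le> K"
    using A by (auto simp: weakly_p_L_set_def bounded_iff)
  have bound: "\<bar>blinfun_apply (s n) x\<bar> \<le> K * norm x" for n x
  proof -
    have "\<bar>blinfun_apply (s n) x\<bar> \<le> norm (s n) * norm x"
      using norm_blinfun[of "s n" x] by simp
    also have "\<dots> \<le> K * norm x"
      using K s by (intro mult_right_mono) auto
    finally show ?thesis .
  qed
  define T :: "'x \<Rightarrow> (nat \<Rightarrow>\<^sub>C real)" where "T x = Bcontfun (\<lambda>n. blinfun_apply (s n) x)" for x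
  have T: "apply_bcontfun (T x) n = blinfun_apply (s n) x" for x n
    unfolding T_def
    by (subst Bcontfun_inverse)
      (auto intro!: bcontfun_normI[where b = "K * norm x"] simp: bound)
  have op: "operator_into ell_infinity T"
    unfolding operator_into_def ell_infinity_def type_space_def
    by (auto intro!: bcontfun_eqI exI[of _ K] norm_bound
        simp: T blinfun.add_right blinfun.scaleR_right bound)
  have conv: "p_convergent p ell_infinity T"
    unfolding p_convergent_def ell_infinity_def type_space_def
  proof (simp, intro allI impI LIMSEQ_I)
    fix x :: "nat \<Rightarrow> 'x" and e :: real
    assume x: "weakly_p_summable p x" and e: "0 < e"
    have "(\<lambda>n. SUP f\<in>A. ennreal \<bar>blinfun_apply f (x n)\<bar>) \<longlonglongrightarrow> 0"
      using A x by (simp add: weakly_p_L_set_def)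
    \<comment> \<open>Half of \<open>e\<close> leaves room, since the supremum norm of a sequence
      with entries below a bound may attain that bound.\<close>
    then have "eventually (\<lambda>n. (SUP f\<in>A. ennreal \<bar>blinfun_apply f (x n)\<bar>) < ennreal (e / 2)) sequentially"
      using e by (intro order_tendstoD) auto
    then obtain N where N: "\<And>n. n \<ge> N \<Longrightarrow> (SUP f\<in>A. ennreal \<bar>blinfun_apply f (x n)\<bar>) < ennreal (e / 2)"
      by (auto simp: eventually_sequentially)
    have "norm (T (x n)) < e" if "n \<ge> N" for n
    proof -
      have "\<bar>blinfun_apply (s m) (x n)\<bar> \<le> e / 2" for m
      proof -
        have "ennreal \<bar>blinfun_apply (s m) (x n)\<bar> \<le> (SUP f\<in>A. ennreal \<bar>blinfun_apply f (x n)\<bar>)"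
          using s by (intro SUP_upper) auto
        also have "\<dots> < ennreal (e / 2)" by (rule N[OF that])
        finally show ?thesis using e by (simp add: ennreal_less_iff)
      qed
      then have "norm (T (x n)) \<le> e / 2"
        by (intro norm_bound) (simp add: T)
      then show ?thesis using e by simp
    qed
    then show "\<exists>N. \<forall>n\<ge>N. norm (norm (T (x n)) - 0) < e" by auto
  qed
  have "range s \<subseteq> adjoint_into T ` unit_ball_on (dual_on ell_infinity)"
  proof clarify
    fix n
    let ?\<delta> = "\<lambda>y :: nat \<Rightarrow>\<^sub>C real. apply_bcontfun y n"
    have "\<bar>?\<delta> y\<bar> \<le> 1 * norm y" for y
      using norm_bounded[of y n] by simp
    moreover from this have "bounded_linear ?\<delta>"
      by (intro bounded_linear_intro[where K = 1]) (auto simp: mult.commute)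
    ultimately have "?\<delta> \<in> unit_ball_on (dual_on ell_infinity)"
      by (auto simp: unit_ball_on_def ell_infinity_def carrier_dual_on_type_space
          vnorm_dual_on_type_space intro!: onorm_bound)
    moreover have "adjoint_into T ?\<delta> = s n"
      by (simp add: adjoint_into_def T blinfun_apply_inverse)
    ultimately show "s n \<in> adjoint_into T ` unit_ball_on (dual_on ell_infinity)"
      by (metis imageI)
  qed
  with op conv show thesis by (rule that)
qed

section \<open>The equivalence for an abstract compactness property\<close>

text \<open>All three versions are instances: the argument uses only that \<open>P\<close> passes to
  subsets and, for bounded sets, is determined by sequences.\<close>

lemma adjoints_of_p_convergent_operators_equiv:
  fixes \<iota> :: "(nat \<Rightarrow>\<^sub>C real) \<Rightarrow> 'u"
    and P :: "('x::real_normed_vector \<Rightarrow>\<^sub>L real) set \<Rightarrow> bool"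
  assumes inj: "inj \<iota>"
    and subset: "\<And>S T. P T \<Longrightarrow> S \<subseteq> T \<Longrightarrow> P S"
    and seq: "\<And>A. bounded A \<Longrightarrow> (\<And>s :: nat \<Rightarrow> 'x \<Rightarrow>\<^sub>L real. range s \<subseteq> A \<Longrightarrow> P (range s)) \<Longrightarrow> P A"
  shows "((\<forall>Y :: 'u nspace. banach_space_on Y \<longrightarrow>
          (\<forall>T :: 'x \<Rightarrow> 'u. operator_into Y T \<and> p_convergent p Y T \<longrightarrow>
            P (adjoint_into T ` unit_ball_on (dual_on Y))))
      \<longleftrightarrow>
      (\<forall>T :: 'x \<Rightarrow> (nat \<Rightarrow>\<^sub>C real). operator_into ell_infinity T \<and> p_convergent p ell_infinity T \<longrightarrow>
            P (adjoint_into T ` unit_ball_on (dual_on ell_infinity))))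
    \<and>
    ((\<forall>T :: 'x \<Rightarrow> (nat \<Rightarrow>\<^sub>C real). operator_into ell_infinity T \<and> p_convergent p ell_infinity T \<longrightarrow>
            P (adjoint_into T ` unit_ball_on (dual_on ell_infinity)))
      \<longleftrightarrow>
      (\<forall>A. weakly_p_L_set p A \<longrightarrow> P A))"
  (is "(?I \<longleftrightarrow> ?II) \<and> (?II \<longleftrightarrow> ?III)")
proof -
  have "?II" if I: ?I
  proof (intro allI impI)
    fix T :: "'x \<Rightarrow> (nat \<Rightarrow>\<^sub>C real)"
    assume T: "operator_into ell_infinity T \<and> p_convergent p ell_infinity T"
    then have "P (adjoint_into (\<lambda>x. \<iota> (T x)) ` unit_ball_on (dual_on (transported_space \<iota>)))"
      using I banach_space_on_transported_space[OF inj convergent_bcontfun]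
        operator_into_transported_space[OF inj] p_convergent_transported_space[OF inj]
      unfolding ell_infinity_def by blast
    then show "P (adjoint_into T ` unit_ball_on (dual_on ell_infinity))"
      unfolding ell_infinity_def
      by (rule subset[OF _ adjoint_unit_ball_transported_space[OF inj]])
  qed
  \<comment> \<open>The operator depends on the chosen sequence, so (ii) reaches only ranges of
    sequences in \<open>A\<close>; \<open>seq\<close> then recovers \<open>A\<close>.\<close>
  moreover have "?III" if II: ?II
  proof (intro allI impI, rule seq)
    fix A :: "('x \<Rightarrow>\<^sub>L real) set" and s :: "nat \<Rightarrow> 'x \<Rightarrow>\<^sub>L real"
    assume A: "weakly_p_L_set p A"
    then show "bounded A" by (simp add: weakly_p_L_set_def)
    assume "range s \<subseteq> A"
    with A obtain T :: "'x \<Rightarrow> (nat \<Rightarrow>\<^sub>C real)"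
      where "operator_into ell_infinity T" "p_convergent p ell_infinity T"
        and "range s \<subseteq> adjoint_into T ` unit_ball_on (dual_on ell_infinity)"
      by (rule weakly_p_L_sequence_as_adjoint)
    with II show "P (range s)" using subset by blast
  qed
  moreover have "?I" if III: ?III
    using III weakly_p_L_set_adjoint_unit_ball banach_space_on.axioms(1) by blast
  ultimately show ?thesis by blast
qed

(* The carriers of the spaces Y range over all subsets of 'u. The type 'u is arbitrary, except that
   it must be large enough to contain a copy of the underlying set of ell_infinity. *)
theorem theorem21:
  fixes p :: real
    and \<iota> :: "(nat \<Rightarrow>\<^sub>C real) \<Rightarrow> 'u"
  assumes "1 \<le> p"
    and "inj \<iota>"
  shows
    "(((\<forall>Y :: 'u nspace. banach_space_on Y \<longrightarrow>
           (\<forall>T :: 'x::banach \<Rightarrow> 'u. operator_into Y T \<and> p_convergent p Y T \<longrightarrow>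
              weakly_precompact_operator (dual_on Y) (adjoint_into T)))
        \<longleftrightarrow>
        (\<forall>T :: 'x \<Rightarrow> (nat \<Rightarrow>\<^sub>C real). operator_into ell_infinity T \<and> p_convergent p ell_infinity T \<longrightarrow>
              weakly_precompact_operator (dual_on ell_infinity) (adjoint_into T)))
       \<and>
       ((\<forall>T :: 'x \<Rightarrow> (nat \<Rightarrow>\<^sub>C real). operator_into ell_infinity T \<and> p_convergent p ell_infinity T \<longrightarrow>
              weakly_precompact_operator (dual_on ell_infinity) (adjoint_into T))
        \<longleftrightarrow>
        (\<forall>A :: ('x \<Rightarrow>\<^sub>L real) set. weakly_p_L_set p A \<longrightarrow> weakly_precompact A)))
     \<and>
     (((\<forall>Y :: 'u nspace. banach_space_on Y \<longrightarrow>
           (\<forall>T :: 'x::banach \<Rightarrow> 'u. operator_into Y T \<and> p_convergent p Y T \<longrightarrow>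
              weakly_compact_operator (dual_on Y) (adjoint_into T)))
        \<longleftrightarrow>
        (\<forall>T :: 'x \<Rightarrow> (nat \<Rightarrow>\<^sub>C real). operator_into ell_infinity T \<and> p_convergent p ell_infinity T \<longrightarrow>
              weakly_compact_operator (dual_on ell_infinity) (adjoint_into T)))
       \<and>
       ((\<forall>T :: 'x \<Rightarrow> (nat \<Rightarrow>\<^sub>C real). operator_into ell_infinity T \<and> p_convergent p ell_infinity T \<longrightarrow>
              weakly_compact_operator (dual_on ell_infinity) (adjoint_into T))
        \<longleftrightarrow>
        (\<forall>A :: ('x \<Rightarrow>\<^sub>L real) set. weakly_p_L_set p A \<longrightarrow> relatively_weakly_compact A)))
     \<and>
     (((\<forall>Y :: 'u nspace. banach_space_on Y \<longrightarrow>
           (\<forall>T :: 'x::banach \<Rightarrow> 'u. operator_into Y T \<and> p_convergent p Y T \<longrightarrow>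
              compact_operator (dual_on Y) (adjoint_into T)))
        \<longleftrightarrow>
        (\<forall>T :: 'x \<Rightarrow> (nat \<Rightarrow>\<^sub>C real). operator_into ell_infinity T \<and> p_convergent p ell_infinity T \<longrightarrow>
              compact_operator (dual_on ell_infinity) (adjoint_into T)))
       \<and>
       ((\<forall>T :: 'x \<Rightarrow> (nat \<Rightarrow>\<^sub>C real). operator_into ell_infinity T \<and> p_convergent p ell_infinity T \<longrightarrow>
              compact_operator (dual_on ell_infinity) (adjoint_into T))
        \<longleftrightarrow>
        (\<forall>A :: ('x \<Rightarrow>\<^sub>L real) set. weakly_p_L_set p A \<longrightarrow> relatively_compact A)))"
proof -
  note equiv = adjoints_of_p_convergent_operators_equiv[OF \<open>inj \<iota>\<close>]
  note precompact = equiv[of weakly_precompact p,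
      OF weakly_precompact_subset weakly_precompact_sequentiallyI]
  note weakly_compact = equiv[of relatively_weakly_compact p,
      OF relatively_weakly_compact_subset dual_relatively_weakly_compactI]
  note compact = equiv[of relatively_compact p,
      OF relatively_compact_subset relatively_compact_sequentiallyI]
  show ?thesis
    unfolding weakly_precompact_operator_def weakly_compact_operator_def compact_operator_def
    by (rule conjI[OF precompact conjI[OF weakly_compact compact]])
qed

end
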